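(* For any infinite dimensional complex Banach space $E$ with open unit ball $B_E$, we have $H^\infty(B_E)\subsetneq\mathcal{B}_{nat}(B_E)$.
   Context: $H(B_E)$ is the space of holomorphic (complex Fréchet differentiable) functions $f:B_E\to\mathbb{C}$; $H^\infty(B_E)$ is the space of bounded functions in $H(B_E)$. For $f\in H(B_E)$ put $\|f\|_{nat}=\sup_{x\in B_E}(1-\|x\|^2)\|f'(x)\|$, where $f'(x)\in E^*$ has the dual norm. $\mathcal{B}_{nat}(B_E)=\{f\in H(B_E):\|f\|_{nat}<\infty\}$. *)

theory Defs
  imports "HOL-Analysis.Analysis"
begin

text \<open>
  Complex Banach spaces. The real structure is the one obtained by restricting scalars
  (\<open>scaleR_eq_scaleC\<close>), so the library's Frechet derivative and operator norm apply.
\<close>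

class complex_banach = banach +
  fixes scaleC :: "complex \<Rightarrow> 'a \<Rightarrow> 'a"  (infixr \<open>*\<^sub>C\<close> 75)
  assumes scaleC_add_right: "a *\<^sub>C (x + y) = a *\<^sub>C x + a *\<^sub>C y"
    and scaleC_add_left: "(a + b) *\<^sub>C x = a *\<^sub>C x + b *\<^sub>C x"
    and scaleC_scaleC: "a *\<^sub>C (b *\<^sub>C x) = (a * b) *\<^sub>C x"
    and scaleR_eq_scaleC: "r *\<^sub>R x = complex_of_real r *\<^sub>C x"
    and norm_scaleC: "norm (a *\<^sub>C x) = cmod a * norm x"

lemma vector_space_scaleC: "vector_space (scaleC :: complex \<Rightarrow> 'a \<Rightarrow> 'a::complex_banach)"
proof
  fix x :: 'a
  show "1 *\<^sub>C x = x"
    using scaleR_eq_scaleC[of 1 x] by simp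
qed (simp_all add: scaleC_add_right scaleC_add_left scaleC_scaleC)

instantiation complex :: complex_banach
begin

definition scaleC_complex :: "complex \<Rightarrow> complex \<Rightarrow> complex" where
  "scaleC_complex = (*)"

instance
  by standard (simp_all add: scaleC_complex_def algebra_simps scaleR_conv_of_real norm_mult)

end

definition infinite_dimensional :: "'a::complex_banach itself \<Rightarrow> bool" where
  "infinite_dimensional _ \<longleftrightarrow>
     \<not> (\<exists>B :: 'a set. finite B \<and> module.span scaleC B = UNIV)"

text \<open>
  \<open>has_derivative\<close> provides a bounded real-linear map; complex linearity is what makes
  the differentiability complex.
\<close>

definition complex_frechet_differentiable_at ::
    "('a::complex_banach \<Rightarrow> complex) \<Rightarrow> 'a \<Rightarrow> bool" where
  "complex_frechet_differentiable_at f x \<longleftrightarrow>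
     (\<exists>D. (f has_derivative D) (at x) \<and> Vector_Spaces.linear scaleC scaleC D)"

text \<open>
  As usual in the library (cf. \<open>holomorphic_on\<close>), functions on the unit ball are total functions
  of which only the values on the ball matter.
\<close>

definition holomorphic_ball :: "('a::complex_banach \<Rightarrow> complex) set" where
  "holomorphic_ball = {f. \<forall>x \<in> ball 0 1. complex_frechet_differentiable_at f x}"

definition H_infinity :: "('a::complex_banach \<Rightarrow> complex) set" where
  "H_infinity = {f \<in> holomorphic_ball. bounded (f ` ball 0 1)}"

text \<open>
  The supremum is taken in the extended nonnegative reals, so that it is meaningful when infinite;
  \<^const>\<open>onorm\<close> of the derivative is its dual norm.
\<close>

definition nat_seminorm :: "('a::complex_banach \<Rightarrow> complex) \<Rightarrow> ennreal" where
  "nat_seminorm f =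
     (SUP x \<in> ball 0 1. ennreal ((1 - (norm x)\<^sup>2) * onorm (frechet_derivative f (at x))))"

definition Bloch_nat :: "('a::complex_banach \<Rightarrow> complex) set" where
  "Bloch_nat = {f \<in> holomorphic_ball. nat_seminorm f < \<infinity>}"

end

theory Submission
  imports Defs "HOL-Complex_Analysis.Cauchy_Integral_Formula"
begin

text \<open>
  For a bounded function the Cauchy inequality on the complex slices \<open>z \<mapsto> f (x + z v)\<close> bounds the
  derivative. In the other direction, if \<open>L\<close> is a functional with \<open>\<bar>L x\<bar> \<le> \<parallel>x\<parallel>\<close> and
  \<open>L u = \<parallel>u\<parallel> = 1\<close>, then \<open>Ln (1 - L x)\<close> is an unbounded Bloch function. The functional
  comes from the Hahn-Banach theorem, proved here by observing that a minimal sublinear functional is linear.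
\<close>

section \<open>Sublinear functionals and the Hahn-Banach theorem\<close>

definition sublinear :: "('a::real_vector \<Rightarrow> real) \<Rightarrow> bool" where
  "sublinear p \<longleftrightarrow> (\<forall>x y. p (x + y) \<le> p x + p y) \<and> (\<forall>c\<ge>0. \<forall>x. p (c *\<^sub>R x) = c * p x)"

text \<open>One inequality suffices for positive homogeneity: applied to \<open>inverse c\<close>
  and the vector \<open>c *\<^sub>R x\<close>, it yields the reverse one.\<close>

lemma sublinearI:
  assumes "\<And>x y. p (x + y) \<le> p x + p y" and "\<And>c x. c > 0 \<Longrightarrow> p (c *\<^sub>R x) \<le> c * p x" and "p 0 = 0"
  shows "sublinear p"
  unfolding sublinear_def
proof (intro conjI allI impI)
  fix c :: real and x assume "c \<ge> 0"
  show "p (c *\<^sub>R x) = c * p x"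
  proof (cases "c = 0")
    case False
    with \<open>c \<ge> 0\<close> have "c > 0" by simp
    have "p x \<le> inverse c * p (c *\<^sub>R x)"
      using assms(2)[of "inverse c" "c *\<^sub>R x"] \<open>c > 0\<close> by simp
    then have "c * p x \<le> p (c *\<^sub>R x)"
      using \<open>c > 0\<close> by (simp add: field_simps)
    with assms(2)[OF \<open>c > 0\<close>, of x] show ?thesis by simp
  qed (simp add: assms(3))
qed (rule assms(1))

lemma sublinear_add: "sublinear p \<Longrightarrow> p (x + y) \<le> p x + p y"
  by (simp add: sublinear_def)

lemma sublinear_scaleR: "sublinear p \<Longrightarrow> c \<ge> 0 \<Longrightarrow> p (c *\<^sub>R x) = c * p x"
  by (simp add: sublinear_def)

lemma sublinear_zero: "sublinear p \<Longrightarrow> p 0 = 0"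
  using sublinear_scaleR[of p 0 0] by simp

lemma sublinear_minus: "sublinear p \<Longrightarrow> - p (- x) \<le> p x"
  using sublinear_add[of p x "- x"] sublinear_zero[of p] by simp

lemma sublinear_norm: "sublinear (norm :: 'a::real_normed_vector \<Rightarrow> real)"
  by (simp add: sublinear_def norm_triangle_ineq)

text \<open>
  A sublinear minorant of \<open>p\<close>, so it equals \<open>p\<close> when \<open>p\<close> is minimal; the term \<open>t = 1\<close> then gives
  \<open>p x + p y \<le> p (x + y)\<close>. The same term at \<open>x = - y\<close> bounds its value at \<open>- y\<close> by \<open>- p y\<close>, which makes a
  linear minorant agree with \<open>p\<close> at \<open>y\<close>.
\<close>

definition directional_inf :: "('a::real_vector \<Rightarrow> real) \<Rightarrow> 'a \<Rightarrow> 'a \<Rightarrow> real" where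
  "directional_inf p y x = (INF t\<in>{0..}. p (x + t *\<^sub>R y) - t * p y)"

lemma directional_inf_bdd_below:
  assumes "sublinear p"
  shows "bdd_below ((\<lambda>t. p (x + t *\<^sub>R y) - t * p y) ` {0..})"
proof (rule bdd_belowI2)
  fix t :: real assume "t \<in> {0..}"
  have "p (t *\<^sub>R y) \<le> p (x + t *\<^sub>R y) + p (- x)"
    using sublinear_add[OF assms, of "x + t *\<^sub>R y" "- x"] by simp
  then show "- p (- x) \<le> p (x + t *\<^sub>R y) - t * p y"
    using sublinear_scaleR[OF assms, of t y] \<open>t \<in> {0..}\<close> by simp
qed

lemma directional_inf_le:
  assumes "sublinear p" and "t \<ge> 0"
  shows "directional_inf p y x \<le> p (x + t *\<^sub>R y) - t * p y"
  unfolding directional_inf_def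
  using assms by (intro cINF_lower directional_inf_bdd_below) auto

lemma directional_inf_greatest:
  assumes "\<And>t. t \<ge> 0 \<Longrightarrow> a \<le> p (x + t *\<^sub>R y) - t * p y"
  shows "a \<le> directional_inf p y x"
  unfolding directional_inf_def using assms by (intro cINF_greatest) auto

lemma directional_inf_le_self: "sublinear p \<Longrightarrow> directional_inf p y x \<le> p x"
  using directional_inf_le[of p 0 y x] by simp

text \<open>For subadditivity, parameters s for x and t for z are merged into s + t for x + z, and
  the infimum is then taken over t and s in turn. Homogeneity comes from the substitution of c * t
  for t.\<close>

lemma sublinear_directional_inf:
  assumes "sublinear p"
  shows "sublinear (directional_inf p y)"
proof (rule sublinearI)
  fix x z :: 'a
  have *: "directional_inf p y (x + z) \<le> (p (x + s *\<^sub>R y) - s * p y) + (p (z + t *\<^sub>R y) - t * p y)"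
    if "s \<ge> 0" "t \<ge> 0" for s t
  proof -
    have "directional_inf p y (x + z) \<le> p ((x + z) + (s + t) *\<^sub>R y) - (s + t) * p y"
      using that by (intro directional_inf_le assms) simp
    also have "(x + z) + (s + t) *\<^sub>R y = (x + s *\<^sub>R y) + (z + t *\<^sub>R y)"
      by (simp add: scaleR_add_left)
    finally show ?thesis
      using sublinear_add[OF assms, of "x + s *\<^sub>R y" "z + t *\<^sub>R y"] by (simp add: algebra_simps)
  qed
  have "directional_inf p y (x + z) - (p (x + s *\<^sub>R y) - s * p y) \<le> directional_inf p y z"
    if "s \<ge> 0" for s
    using *[OF that] by (intro directional_inf_greatest) (simp add: algebra_simps)
  then have "directional_inf p y (x + z) - directional_inf p y z \<le> directional_inf p y x"
    by (intro directional_inf_greatest) (simp add: algebra_simps)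
  then show "directional_inf p y (x + z) \<le> directional_inf p y x + directional_inf p y z"
    by simp
next
  fix c :: real and x :: 'a assume "c > 0"
  have "inverse c * directional_inf p y (c *\<^sub>R x) \<le> directional_inf p y x"
  proof (rule directional_inf_greatest)
    fix t :: real assume "t \<ge> 0"
    have "directional_inf p y (c *\<^sub>R x) \<le> p (c *\<^sub>R x + (c * t) *\<^sub>R y) - (c * t) * p y"
      using \<open>c > 0\<close> \<open>t \<ge> 0\<close> by (intro directional_inf_le assms) simp
    also have "c *\<^sub>R x + (c * t) *\<^sub>R y = c *\<^sub>R (x + t *\<^sub>R y)"
      by (simp add: scaleR_add_right)
    also have "p \<dots> = c * p (x + t *\<^sub>R y)"
      using \<open>c > 0\<close> by (intro sublinear_scaleR assms) simp
    finally show "inverse c * directional_inf p y (c *\<^sub>R x) \<le> p (x + t *\<^sub>R y) - t * p y"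
      using \<open>c > 0\<close> by (simp add: field_simps)
  qed
  then show "directional_inf p y (c *\<^sub>R x) \<le> c * directional_inf p y x"
    using \<open>c > 0\<close> by (simp add: field_simps)
next
  have "directional_inf p y 0 \<le> 0"
    using directional_inf_le_self[OF assms, of y 0] sublinear_zero[OF assms] by simp
  moreover have "0 \<le> directional_inf p y 0"
    using sublinear_scaleR[OF assms] by (intro directional_inf_greatest) simp
  ultimately show "directional_inf p y 0 = 0" by simp
qed

text \<open>Pointwise infima of sublinear functionals need not be subadditive. In a chain, the
  smaller r of p and q gives r x + r y \<le> p x + q y, so the two infima on the right can be taken
  independently.\<close>

lemma sublinear_Inf_chain:
  fixes C :: "('a::real_vector \<Rightarrow> real) set"
  assumes sub: "\<And>p. p \<in> C \<Longrightarrow> sublinear p" and "C \<noteq> {}"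
    and chain: "\<And>p q. p \<in> C \<Longrightarrow> q \<in> C \<Longrightarrow> p \<le> q \<or> q \<le> p"
    and bdd: "\<And>x. bdd_below ((\<lambda>p. p x) ` C)"
  shows "sublinear (\<lambda>x. INF p\<in>C. p x)"
proof (rule sublinearI)
  let ?m = "\<lambda>x. INF p\<in>C. p x"
  have lower: "?m x \<le> p x" if "p \<in> C" for p x
    using bdd that by (intro cINF_lower)
  fix x y :: 'a
  have *: "?m (x + y) \<le> p x + q y" if pq: "p \<in> C" "q \<in> C" for p q :: "'a \<Rightarrow> real"
  proof -
    obtain r where "r \<in> C" "r \<le> p" "r \<le> q"
      using chain[OF pq] pq by blast
    have "?m (x + y) \<le> r x + r y"
      using lower[OF \<open>r \<in> C\<close>, of "x + y"] sublinear_add[OF sub[OF \<open>r \<in> C\<close>], of x y] by linarith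
    also have "\<dots> \<le> p x + q y"
      using \<open>r \<le> p\<close> \<open>r \<le> q\<close> by (simp add: add_mono le_funD)
    finally show ?thesis .
  qed
  have "?m (x + y) - p x \<le> ?m y" if "p \<in> C" for p
    using *[OF that] \<open>C \<noteq> {}\<close> by (intro cINF_greatest) (auto simp: algebra_simps)
  then have "?m (x + y) - ?m y \<le> ?m x"
    using \<open>C \<noteq> {}\<close> by (intro cINF_greatest) (auto simp: algebra_simps)
  then show "?m (x + y) \<le> ?m x + ?m y" by simp
  show "?m (c *\<^sub>R x) \<le> c * ?m x" if "c > 0" for c
  proof -
    have "inverse c * ?m (c *\<^sub>R x) \<le> ?m x"
    proof (rule cINF_greatest[OF \<open>C \<noteq> {}\<close>])
      fix p assume "p \<in> C"
      then show "inverse c * ?m (c *\<^sub>R x) \<le> p x"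
        using lower[of p "c *\<^sub>R x"] sublinear_scaleR[OF sub, of p c x] \<open>c > 0\<close>
        by (simp add: field_simps)
    qed
    then show ?thesis using \<open>c > 0\<close> by (simp add: field_simps)
  qed
  have "(\<lambda>p. p 0) ` C = {0}"
    using \<open>C \<noteq> {}\<close> sublinear_zero[OF sub] by force
  then show "?m 0 = 0" by simp
qed

lemma minimal_sublinear_linear:
  assumes "sublinear q" and min: "\<And>r. sublinear r \<Longrightarrow> r \<le> q \<Longrightarrow> r = q"
  shows "linear q"
proof -
  have "directional_inf q y = q" for y
    by (intro min sublinear_directional_inf le_funI directional_inf_le_self assms(1))
  then have "q x \<le> q (x + y) - q y" for x y
    using directional_inf_le[OF assms(1), of 1 y x] by simp
  then have add: "q (x + y) = q x + q y" for x y
    using sublinear_add[OF assms(1), of x y] by (intro antisym) (auto simp: algebra_simps)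
  have minus: "q (- x) = - q x" for x
    using add[of x "- x"] sublinear_zero[OF assms(1)] by simp
  show ?thesis
  proof (rule linearI)
    fix c :: real and x
    show "q (c *\<^sub>R x) = c *\<^sub>R q x"
    proof (cases "c \<ge> 0")
      case False
      then have "q ((- c) *\<^sub>R x) = - c * q x"
        by (intro sublinear_scaleR assms(1)) simp
      then show ?thesis by (simp add: minus)
    qed (simp add: sublinear_scaleR assms(1))
  qed (rule add)
qed

text \<open>Zorn's lemma gives a minimal element m of the sublinear minorants of p. Whatever lies
  below m also lies below p, so m is minimal among all sublinear functionals and hence
  linear.\<close>

theorem Hahn_Banach_sublinear:
  assumes "sublinear p"
  obtains q where "linear q" and "q \<le> p"
proof -
  define A where "A = {r. sublinear r \<and> r \<le> p}"
  \<comment> \<open>The order is reversed, so that Zorn's maximal elements are minimal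
    functionals.\<close>
  let ?R = "relation_of (\<lambda>r s. s \<le> r) A"
  have "\<exists>m\<in>A. \<forall>r\<in>A. r \<le> m \<longrightarrow> r = m"
  proof (rule predicate_Zorn)
    show "partial_order_on A ?R"
      by (rule partial_order_on_relation_ofI) auto
    fix C assume "C \<in> Chains ?R"
    then have sub: "\<And>r. r \<in> C \<Longrightarrow> r \<in> A" and chain: "\<And>r s. r \<in> C \<Longrightarrow> s \<in> C \<Longrightarrow> r \<le> s \<or> s \<le> r"
      by (auto simp: Chains_def relation_of_def)
    show "\<exists>u\<in>A. \<forall>r\<in>C. u \<le> r"
    proof (cases "C = {}")
      case True
      then show ?thesis using assms by (auto simp: A_def)
    next
      case False
      \<comment> \<open>The bound is uniform in r because - p (- x) \<le> - r (- x) \<le> r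
        x.\<close>
      have bdd: "bdd_below ((\<lambda>r. r x) ` C)" for x
      proof (rule bdd_belowI2)
        fix r assume "r \<in> C"
        then have "sublinear r" "r (- x) \<le> p (- x)"
          using sub by (auto simp: A_def le_fun_def)
        then show "- p (- x) \<le> r x"
          using sublinear_minus[of r x] by simp
      qed
      let ?m = "\<lambda>x. INF r\<in>C. r x"
      have lower: "?m \<le> r" if "r \<in> C" for r
        using bdd that by (auto intro!: le_funI cINF_lower)
      have "sublinear ?m"
        using sub chain bdd False by (intro sublinear_Inf_chain) (auto simp: A_def)
      moreover have "?m \<le> p"
        using False sub lower by (auto simp: A_def intro: order_trans)
      ultimately show ?thesis
        using lower by (intro bexI[of _ ?m]) (auto simp: A_def)
    qed
  qed
  then obtain m where "m \<in> A" and min: "\<And>r. r \<in> A \<Longrightarrow> r \<le> m \<Longrightarrow> r = m"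
    by blast
  have "linear m"
    using \<open>m \<in> A\<close> min by (intro minimal_sublinear_linear) (auto simp: A_def intro: order_trans)
  with \<open>m \<in> A\<close> show ?thesis
    by (intro that) (auto simp: A_def)
qed

text \<open>Instead of extending a functional from the line through u, the norm is replaced by the
  smaller \<open>directional_inf norm u\<close>, whose linear minorants are all norming at
  u.\<close>

lemma real_norming_functional:
  fixes u :: "'a::real_normed_vector"
  obtains q :: "'a \<Rightarrow> real" where "linear q" "\<And>x. q x \<le> norm x" "q u = norm u"
proof -
  obtain q where q: "linear q" "q \<le> directional_inf norm u"
    using Hahn_Banach_sublinear[OF sublinear_directional_inf[OF sublinear_norm]] by blast
  have le: "q x \<le> norm x" for x
    using le_funD[OF q(2), of x] directional_inf_le_self[OF sublinear_norm, of u x] by linarith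
  have "q (- u) \<le> - norm u"
    using le_funD[OF q(2), of "- u"] directional_inf_le[OF sublinear_norm, of 1 u "- u"] by simp
  then have "norm u \<le> q u"
    by (simp add: linear_neg[OF q(1)])
  with le[of u] show ?thesis
    by (intro that[of q] q(1) le antisym)
qed

section \<open>Complex functionals\<close>

abbreviation complex_linear :: "('a::complex_banach \<Rightarrow> complex) \<Rightarrow> bool" where
  "complex_linear \<equiv> Vector_Spaces.linear scaleC scaleC"

lemma complex_linear_iff:
  "complex_linear D \<longleftrightarrow> (\<forall>x y. D (x + y) = D x + D y) \<and> (\<forall>c x. D (c *\<^sub>C x) = c * D x)"
  using vector_space_scaleC[where 'a = 'a] vector_space_scaleC[where 'a = complex]
  by (simp add: Vector_Spaces.linear_iff scaleC_complex_def)

lemma scaleC_minus_one: "(- 1) *\<^sub>C x = - (x :: 'a::complex_banach)"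
  using scaleR_eq_scaleC[of "- 1" x] by simp

lemma complex_norming_functional:
  fixes u :: "'a::complex_banach"
  obtains L :: "'a \<Rightarrow> complex"
    where "complex_linear L" "\<And>x. cmod (L x) \<le> norm x" "L u = norm u"
proof -
  obtain q :: "'a \<Rightarrow> real" where q: "linear q" "\<And>x. q x \<le> norm x" "q u = norm u"
    using real_norming_functional by blast
  \<comment> \<open>A complex-linear L with real part q must have this form, since Im (L x) = - Re
    (\<i> * L x) = - Re (L (\<i> x)).\<close>
  define L where "L x = Complex (q x) (- q (\<i> *\<^sub>C x))" for x
  have add: "L (x + y) = L x + L y" for x y
    by (simp add: L_def complex_eq_iff scaleC_add_right linear_add[OF q(1)])
  have of_real: "L (complex_of_real r *\<^sub>C x) = r * L x" for r x
  proof -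
    have "\<i> *\<^sub>C (complex_of_real r *\<^sub>C x) = r *\<^sub>R (\<i> *\<^sub>C x)"
      by (simp add: scaleR_eq_scaleC scaleC_scaleC mult.commute)
    then show ?thesis
      by (simp add: L_def complex_eq_iff linear_scale[OF q(1)] flip: scaleR_eq_scaleC)
  qed
  have i: "L (\<i> *\<^sub>C x) = \<i> * L x" for x
    by (simp add: L_def complex_eq_iff scaleC_scaleC scaleC_minus_one linear_neg[OF q(1)])
  have scale: "L (c *\<^sub>C x) = c * L x" for c x
  proof -
    have "c *\<^sub>C x = (complex_of_real (Re c) + \<i> * complex_of_real (Im c)) *\<^sub>C x"
      by (simp flip: complex_eq)
    also have "\<dots> = complex_of_real (Re c) *\<^sub>C x + \<i> *\<^sub>C (complex_of_real (Im c) *\<^sub>C x)"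
      by (simp add: scaleC_scaleC scaleC_add_left)
    finally have "L (c *\<^sub>C x) = Re c * L x + \<i> * (Im c * L x)"
      by (simp only: add i of_real)
    also have "\<dots> = c * L x"
      by (simp add: complex_eq_iff)
    finally show ?thesis .
  qed
  have bound: "cmod (L x) \<le> norm x" for x
  proof (cases "L x = 0")
    case False
    \<comment> \<open>Rotating x by this unimodular c makes L real and nonnegative there, so the
      modulus of L x becomes a value of q.\<close>
    define c where "c = cnj (sgn (L x))"
    have "c * L x = of_real (cmod (L x))"
      using False by (simp add: c_def sgn_eq complex_norm_square[symmetric] field_simps power2_eq_square)
    then have "cmod (L x) = Re (L (c *\<^sub>C x))"
      by (simp add: scale)
    also have "\<dots> = q (c *\<^sub>C x)"
      by (simp add: L_def)
    also have "\<dots> \<le> norm (c *\<^sub>C x)"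
      by (rule q(2))
    also have "\<dots> = norm x"
      using False by (simp add: c_def norm_scaleC norm_sgn)
    finally show ?thesis .
  qed simp
  have "Re (L u) = norm u"
    by (simp add: L_def q(3))
  \<comment> \<open>The real part already exhausts the bound \<open>norm u\<close> on the
    modulus.\<close>
  moreover have "Im (L u) = 0"
    using bound[of u] \<open>Re (L u) = norm u\<close> cmod_power2[of "L u"]
      power_mono[of "cmod (L u)" "norm u" 2] by (smt (verit) norm_ge_zero zero_eq_power2 zero_le_power2)
  ultimately show ?thesis
    by (intro that[of L]) (auto simp: complex_linear_iff add scale bound complex_eq_iff)
qed

section \<open>Bloch functions\<close>

text \<open>The weight factors as (1 - \<open>norm x\<close>) * (1 + \<open>norm x\<close>): the
  first factor cancels the growth of the derivative, the second is at most 2.\<close>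

lemma Bloch_natI:
  fixes f :: "'a::complex_banach \<Rightarrow> complex"
  assumes D: "\<And>x. norm x < 1 \<Longrightarrow> (f has_derivative D x) (at x)"
    and linear: "\<And>x. norm x < 1 \<Longrightarrow> complex_linear (D x)"
    and bound: "\<And>x v. norm x < 1 \<Longrightarrow> cmod (D x v) \<le> C / (1 - norm x) * norm v"
  shows "f \<in> Bloch_nat"
proof -
  have "(1 - (norm x)\<^sup>2) * onorm (frechet_derivative f (at x)) \<le> 2 * \<bar>C\<bar>" if "norm x < 1" for x
  proof -
    \<comment> \<open>The sign of C is not known, and \<open>onorm_bound\<close> asks for a
      nonnegative constant.\<close>
    have "C / (1 - norm x) * norm v \<le> \<bar>C\<bar> / (1 - norm x) * norm v" for v :: 'a
      using that by (intro mult_right_mono divide_right_mono) auto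
    then have "cmod (D x v) \<le> \<bar>C\<bar> / (1 - norm x) * norm v" for v
      using bound[OF that] order_trans by blast
    then have "onorm (D x) \<le> \<bar>C\<bar> / (1 - norm x)"
      using that by (intro onorm_bound) auto
    moreover have "frechet_derivative f (at x) = D x"
      using frechet_derivative_at[OF D[OF that]] by simp
    moreover have "(norm x)\<^sup>2 \<le> 1"
      using that by (simp add: power_le_one)
    ultimately have "(1 - (norm x)\<^sup>2) * onorm (frechet_derivative f (at x))
        \<le> (1 - (norm x)\<^sup>2) * (\<bar>C\<bar> / (1 - norm x))"
      by (intro mult_left_mono) auto
    also have "\<dots> = (1 + norm x) * \<bar>C\<bar>"
      using that by (simp add: field_simps power2_eq_square)
    also have "\<dots> \<le> 2 * \<bar>C\<bar>"
      using that by (intro mult_right_mono) auto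
    finally show ?thesis .
  qed
  then have "nat_seminorm f \<le> ennreal (2 * \<bar>C\<bar>)"
    unfolding nat_seminorm_def by (intro SUP_least ennreal_leI) auto
  also have "\<dots> < \<infinity>" by simp
  finally show ?thesis
    unfolding Bloch_nat_def holomorphic_ball_def complex_frechet_differentiable_at_def
    by (auto intro!: exI[of _ "D x" for x] D linear)
qed

section \<open>Cauchy estimates on complex slices\<close>

lemma bounded_linear_scaleC_left: "bounded_linear (\<lambda>z. z *\<^sub>C (v :: 'a::complex_banach))"
  by (rule bounded_linear_intro[where K = "norm v"])
    (simp_all add: scaleC_add_left norm_scaleC scaleR_eq_scaleC[where 'a = 'a] scaleC_scaleC
      scaleR_conv_of_real)

text \<open>Complex linearity turns D (w v) into w * D v, so the Frechet derivative along the slice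
  is multiplication by the number D v.\<close>

lemma has_field_derivative_slice:
  fixes f :: "'a::complex_banach \<Rightarrow> complex"
  assumes "(f has_derivative D) (at (x + z *\<^sub>C v))" and "complex_linear D"
  shows "((\<lambda>w. f (x + w *\<^sub>C v)) has_field_derivative D v) (at z)"
proof -
  have "((\<lambda>w. x + w *\<^sub>C v) has_derivative (\<lambda>w. w *\<^sub>C v)) (at z)"
    by (auto intro!: derivative_eq_intros bounded_linear.has_derivative[OF bounded_linear_scaleC_left])
  from has_derivative_compose[OF this assms(1)]
  have "((\<lambda>w. f (x + w *\<^sub>C v)) has_derivative (\<lambda>w. D (w *\<^sub>C v))) (at z)"
    by simp
  moreover have "(\<lambda>w. D (w *\<^sub>C v)) = (*) (D v)"
    using assms(2) by (auto simp: complex_linear_iff)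
  ultimately show ?thesis
    by (simp add: has_field_derivative_def)
qed

lemma derivative_bound:
  fixes f :: "'a::complex_banach \<Rightarrow> complex"
  assumes D: "\<And>x. norm x < 1 \<Longrightarrow> (f has_derivative D x) (at x)"
    and linear: "\<And>x. norm x < 1 \<Longrightarrow> complex_linear (D x)"
    and M: "\<And>x. norm x < 1 \<Longrightarrow> cmod (f x) \<le> M"
    and "norm x < 1"
  shows "cmod (D x v) \<le> (2 * M) / (1 - norm x) * norm v"
proof (cases "v = 0")
  case True
  have "D x 0 = 0"
    using linear_0[OF has_derivative_linear[OF D[OF \<open>norm x < 1\<close>]]] .
  with True show ?thesis by simp
next
  case False
  \<comment> \<open>With this radius the slice moves x by at most half its distance to the unit
    sphere, so the closed disc stays inside the ball. Then M / r is exactly the claimed bound, which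
    is where the factor 2 comes from.\<close>
  define r where "r = (1 - norm x) / (2 * norm v)"
  have "r > 0"
    using False \<open>norm x < 1\<close> by (simp add: r_def)
  have inside: "norm (x + z *\<^sub>C v) < 1" if "cmod z \<le> r" for z
  proof -
    have "norm (z *\<^sub>C v) \<le> r * norm v"
      using that by (simp add: norm_scaleC mult_right_mono)
    also have "\<dots> = (1 - norm x) / 2"
      using False by (simp add: r_def)
    finally show ?thesis
      using norm_triangle_ineq[of x "z *\<^sub>C v"] \<open>norm x < 1\<close> by (simp add: field_simps)
  qed
  let ?g = "\<lambda>z. f (x + z *\<^sub>C v)"
  have g: "(?g has_field_derivative D (x + z *\<^sub>C v) v) (at z)" if "cmod z \<le> r" for z
    using inside[OF that] by (intro has_field_derivative_slice D linear)
  have zero: "0 *\<^sub>C v = 0"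
    using scaleR_eq_scaleC[of 0 v] by simp
  have "cmod ((deriv ^^ 1) ?g 0) \<le> fact 1 * M / r ^ 1"
  proof (rule Cauchy_inequality)
    show "?g holomorphic_on ball 0 r"
      unfolding holomorphic_on_def field_differentiable_def
    proof
      fix z :: complex assume "z \<in> ball 0 r"
      then show "\<exists>d. (?g has_field_derivative d) (at z within ball 0 r)"
        using has_field_derivative_at_within[OF g[of z]] by auto
    qed
    show "continuous_on (cball 0 r) ?g"
      using g by (intro continuous_at_imp_continuous_on ballI) (auto intro: DERIV_isCont)
    show "cmod (?g z) \<le> M" if "cmod (0 - z) = r" for z
      using that by (intro M inside) simp
  qed (fact \<open>r > 0\<close>)
  moreover have "deriv ?g 0 = D x v"
    using DERIV_imp_deriv[OF g[of 0]] \<open>r > 0\<close> by (simp add: zero)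
  ultimately show ?thesis
    using False \<open>norm x < 1\<close> by (simp add: r_def field_simps)
qed

lemma H_infinity_subset_Bloch_nat: "H_infinity \<subseteq> (Bloch_nat :: ('a::complex_banach \<Rightarrow> complex) set)"
proof
  fix f :: "'a \<Rightarrow> complex" assume "f \<in> H_infinity"
  then have "\<forall>x. norm x < 1 \<longrightarrow> (\<exists>D. (f has_derivative D) (at x) \<and> complex_linear D)"
    and "bounded (f ` ball 0 1)"
    by (auto simp: H_infinity_def holomorphic_ball_def complex_frechet_differentiable_at_def)
  then obtain D M where D: "\<And>x. norm x < 1 \<Longrightarrow> (f has_derivative D x) (at x)"
    "\<And>x. norm x < 1 \<Longrightarrow> complex_linear (D x)" and M: "\<And>x. norm x < 1 \<Longrightarrow> cmod (f x) \<le> M"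
    unfolding bounded_iff by (metis image_eqI mem_ball_0)
  show "f \<in> Bloch_nat"
    by (rule Bloch_natI[OF D derivative_bound[OF D M]])
qed

section \<open>An unbounded Bloch function\<close>

lemma Ln_functional_Bloch_nat:
  fixes L :: "'a::complex_banach \<Rightarrow> complex"
  assumes "complex_linear L" and bound: "\<And>x. cmod (L x) \<le> norm x"
  shows "(\<lambda>x. Ln (1 - L x)) \<in> Bloch_nat"
proof (rule Bloch_natI)
  have add: "L (x + y) = L x + L y" and scale: "L (c *\<^sub>C x) = c * L x" for x y c
    using assms(1) by (auto simp: complex_linear_iff)
  have L: "bounded_linear L"
    by (rule bounded_linear_intro[where K = 1])
      (simp_all add: add scale scaleR_eq_scaleC[where 'a = 'a] scaleR_conv_of_real bound)
  fix x :: 'a assume x: "norm x < 1"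
  \<comment> \<open>Thus 1 - L x lies in the right half-plane, away from the branch cut of
    \<open>Ln\<close>.\<close>
  have "cmod (L x) < 1"
    using bound[of x] x by simp
  then have "Re (L x) < 1"
    using complex_Re_le_cmod[of "L x"] by linarith
  then have "1 - L x \<notin> \<real>\<^sub>\<le>\<^sub>0"
    by (auto simp: complex_nonpos_Reals_iff)
  then have "(Ln has_derivative (*) (inverse (1 - L x))) (at (1 - L x))"
    using has_field_derivative_Ln[of "1 - L x"] by (simp add: has_field_derivative_def)
  moreover have "((\<lambda>x. 1 - L x) has_derivative (\<lambda>v. - L v)) (at x)"
    by (auto intro!: derivative_eq_intros bounded_linear.has_derivative[OF L])
  ultimately show "((\<lambda>x. Ln (1 - L x)) has_derivative (\<lambda>v. inverse (1 - L x) * - L v)) (at x)"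
    by (rule has_derivative_compose[rotated])
  show "complex_linear (\<lambda>v. inverse (1 - L x) * - L v)"
    by (simp add: complex_linear_iff add scale algebra_simps)
  fix v
  \<comment> \<open>This controls the denominator of the derivative - L v / (1 - L x), so
    \<open>Bloch_natI\<close> applies with C = 1.\<close>
  have "1 - norm x \<le> cmod (1 - L x)"
    using norm_triangle_ineq2[of 1 "L x"] bound[of x] by simp
  then have "cmod (L v) / cmod (1 - L x) \<le> norm v / (1 - norm x)"
    using x by (intro frac_le bound) auto
  then show "cmod (inverse (1 - L x) * - L v) \<le> 1 / (1 - norm x) * norm v"
    by (simp add: norm_mult norm_inverse norm_divide field_simps)
qed

lemma Ln_functional_unbounded:
  fixes L :: "'a::complex_banach \<Rightarrow> complex"
  assumes "complex_linear L" and "norm u = 1" and "L u = 1"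
  shows "\<not> bounded ((\<lambda>x. Ln (1 - L x)) ` ball 0 1)"
proof
  assume "bounded ((\<lambda>x. Ln (1 - L x)) ` ball 0 1)"
  then obtain M where M: "\<And>x. norm x < 1 \<Longrightarrow> cmod (Ln (1 - L x)) \<le> M"
    unfolding bounded_iff by (metis image_eqI mem_ball_0)
  \<comment> \<open>At the point (1 - e) u the function takes the value ln e, and e is chosen so
    that this is - (\<bar>M\<bar> + 1), of modulus larger than M.\<close>
  define e where "e = exp (- (\<bar>M\<bar> + 1))"
  have e: "0 < e" "e < 1"
    by (auto simp: e_def)
  let ?x = "complex_of_real (1 - e) *\<^sub>C u"
  have "L ?x = 1 - complex_of_real e"
    using assms by (simp add: complex_linear_iff)
  then have "Ln (1 - L ?x) = of_real (- (\<bar>M\<bar> + 1))"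
    using e(1) by (simp add: Ln_of_real) (simp add: e_def)
  moreover have "norm ?x < 1"
    using e assms(2) by (simp add: norm_scaleC del: of_real_diff)
  ultimately have "cmod (of_real (- (\<bar>M\<bar> + 1))) \<le> M"
    using M by metis
  then show False
    unfolding norm_of_real by linarith
qed

theorem proposition3p6:
  assumes "infinite_dimensional TYPE('a::complex_banach)"
  shows "(H_infinity :: ('a \<Rightarrow> complex) set) \<subset> Bloch_nat"
proof -
  \<comment> \<open>In the zero space the empty set would span, contradicting infinite dimension. A
    nonzero vector is then normalised by \<open>sgn\<close>.\<close>
  have "\<exists>u :: 'a. u \<noteq> 0"
  proof (rule ccontr)
    assume "\<nexists>u :: 'a. u \<noteq> 0"
    then have "module.span scaleC {} = (UNIV :: 'a set)"
      using module.span_empty[OF vector_space_scaleC[folded module_iff_vector_space]] by auto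
    with assms show False
      unfolding infinite_dimensional_def by blast
  qed
  then obtain u :: 'a where "norm u = 1"
    using norm_sgn by metis
  obtain L :: "'a \<Rightarrow> complex"
    where L: "complex_linear L" "\<And>x. cmod (L x) \<le> norm x" "L u = norm u"
    using complex_norming_functional[of u] by blast
  have "(\<lambda>x. Ln (1 - L x)) \<in> Bloch_nat - H_infinity"
    using Ln_functional_Bloch_nat[OF L(1,2)] Ln_functional_unbounded[OF L(1) \<open>norm u = 1\<close>] L(3)
      \<open>norm u = 1\<close> by (auto simp: H_infinity_def)
  with H_infinity_subset_Bloch_nat show ?thesis by blast
qed

end
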